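(* Let $G$ be a finite group and let $g\in G$. Then $$\mathrm{Pr}_g(G,\mathrm{Aut}(G)) \leq \mathrm{Pr}(G,\mathrm{Aut}(G)),$$ and equality holds if and only if $g = 1$.
   Context: For a finite group $G$ with automorphism group $\mathrm{Aut}(G)$, $x\in G$ and $\alpha\in\mathrm{Aut}(G)$, write $[x,\alpha] := x^{-1}\alpha(x)$. For $g \in G$, $$\mathrm{Pr}_g(G,\mathrm{Aut}(G)) := \frac{|\{(x,\alpha)\in G\times \mathrm{Aut}(G) : [x,\alpha]=g\}|}{|G||\mathrm{Aut}(G)|},$$ and $\mathrm{Pr}(G,\mathrm{Aut}(G)) := \mathrm{Pr}_1(G,\mathrm{Aut}(G))$. *)

theory Defs
  imports Complex_Main "HOL-Algebra.Bij"
begin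

definition autocommutator :: "('a, 'b) monoid_scheme \<Rightarrow> 'a \<Rightarrow> ('a \<Rightarrow> 'a) \<Rightarrow> 'a"
  where "autocommutator G x \<alpha> = inv\<^bsub>G\<^esub> x \<otimes>\<^bsub>G\<^esub> \<alpha> x"

(* The library's auto G consists of the automorphisms that are extensional (undefined outside
   carrier G), so each automorphism is counted exactly once, and auto G is finite if carrier G is. *)
definition Pr_autocomm_eq :: "('a, 'b) monoid_scheme \<Rightarrow> 'a \<Rightarrow> real"
  where "Pr_autocomm_eq G g =
    real (card {(x, \<alpha>) \<in> carrier G \<times> auto G. autocommutator G x \<alpha> = g})
      / (real (card (carrier G)) * real (card (auto G)))"

definition Pr_autocomm :: "('a, 'b) monoid_scheme \<Rightarrow> real"
  where "Pr_autocomm G = Pr_autocomm_eq G \<one>\<^bsub>G\<^esub>"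

end

theory Submission
  imports Defs
begin

text \<open>Fix \<open>x\<close> and count automorphisms. The equation \<open>[x, \<alpha>] = g\<close> says \<open>\<alpha> x = x g\<close>, and the
  automorphisms taking \<open>x\<close> to a given element are either none at all or a left coset of the
  stabiliser of \<open>x\<close> in the automorphism group. Hence they are at most as many as the
  automorphisms fixing \<open>x\<close>, which are the solutions of \<open>[x, \<alpha>] = 1\<close>. Summing over \<open>x\<close> gives the
  inequality (\<open>card_auto_maps_to_le_stabiliser\<close>).

  If \<open>g \<noteq> 1\<close>, the inequality is strict already in the summand \<open>x = 1\<close>: every automorphism
  fixes \<open>1\<close>, so \<open>[1, \<alpha>] = g\<close> has no solution, whereas \<open>[1, \<alpha>] = 1\<close> is solved by all of the
  (nonempty) automorphism group.\<close>

lemma finite_auto: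
  assumes "finite (carrier G)"
  shows "finite (auto G)"
proof -
  have "auto G \<subseteq> (\<Pi>\<^sub>E x\<in>carrier G. carrier G)"
    unfolding auto_def Bij_def by (auto simp: PiE_def hom_def)
  then show ?thesis
    using assms by (meson finite_PiE finite_subset)
qed

context group
begin

text \<open>Left translation by \<open>\<beta>\<^sup>-\<^sup>1\<close>, for any one automorphism \<open>\<beta>\<close> taking \<open>x\<close> to \<open>y\<close>, carries the
  automorphisms taking \<open>x\<close> to \<open>y\<close> injectively into the stabiliser of \<open>x\<close>.\<close>
lemma card_auto_maps_to_le_stabiliser:
  assumes fin: "finite (carrier G)" and x: "x \<in> carrier G"
  shows "card {\<alpha> \<in> auto G. \<alpha> x = y} \<le> card {\<alpha> \<in> auto G. \<alpha> x = x}"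
proof (cases "\<exists>\<beta>. \<beta> \<in> auto G \<and> \<beta> x = y")
  case False
  then have "{\<alpha> \<in> auto G. \<alpha> x = y} = {}"
    by blast
  then show ?thesis
    by (simp only: card.empty zero_le)
next
  case True
  then obtain \<beta> where \<beta>: "\<beta> \<in> auto G" "\<beta> x = y"
    by blast
  let ?B = "BijGroup (carrier G)"
  interpret B: group ?B
    by (rule group_BijGroup)
  interpret A: subgroup "auto G" ?B
    by (rule subgroup_auto)
  have inv_\<beta>: "inv\<^bsub>?B\<^esub> \<beta> \<in> auto G"
    using \<beta> by simp
  have mult_apply: "(f \<otimes>\<^bsub>?B\<^esub> h) x = f (h x)" if "f \<in> auto G" "h \<in> auto G" for f h
    using that x by (simp add: BijGroup_def auto_def compose_eq)
  have "(inv\<^bsub>?B\<^esub> \<beta> \<otimes>\<^bsub>?B\<^esub> \<beta>) x = x"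
    using \<beta> x by (simp add: B.l_inv) (simp add: BijGroup_def)
  then have inv_y: "(inv\<^bsub>?B\<^esub> \<beta>) y = x"
    using mult_apply[OF inv_\<beta> \<beta>(1)] \<beta>(2) by simp
  show ?thesis
  proof (rule card_inj_on_le)
    show "inj_on (\<lambda>\<alpha>. inv\<^bsub>?B\<^esub> \<beta> \<otimes>\<^bsub>?B\<^esub> \<alpha>) {\<alpha> \<in> auto G. \<alpha> x = y}"
      using inv_\<beta> by (auto simp: inj_on_def)
    show "(\<lambda>\<alpha>. inv\<^bsub>?B\<^esub> \<beta> \<otimes>\<^bsub>?B\<^esub> \<alpha>) ` {\<alpha> \<in> auto G. \<alpha> x = y} \<subseteq> {\<alpha> \<in> auto G. \<alpha> x = x}"
      using inv_\<beta> inv_y mult_apply by auto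
    show "finite {\<alpha> \<in> auto G. \<alpha> x = x}"
      using finite_auto[OF fin] by simp
  qed
qed

lemma autocommutator_eq_iff:
  assumes "x \<in> carrier G" "g \<in> carrier G" "\<alpha> \<in> auto G"
  shows "autocommutator G x \<alpha> = g \<longleftrightarrow> \<alpha> x = x \<otimes> g"
proof -
  have "\<alpha> x \<in> carrier G"
    using assms by (auto simp: auto_def hom_def)
  then show ?thesis
    unfolding autocommutator_def using assms by (metis inv_solve_left)
qed

lemma card_autocommutator_eq_sum:
  assumes "finite (carrier G)" "g \<in> carrier G"
  shows "card {(x, \<alpha>) \<in> carrier G \<times> auto G. autocommutator G x \<alpha> = g}
    = (\<Sum>x\<in>carrier G. card {\<alpha> \<in> auto G. \<alpha> x = x \<otimes> g})"
proof -
  have "{(x, \<alpha>) \<in> carrier G \<times> auto G. autocommutator G x \<alpha> = g}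
    = Sigma (carrier G) (\<lambda>x. {\<alpha> \<in> auto G. \<alpha> x = x \<otimes> g})"
    using assms(2) by (simp add: set_eq_iff autocommutator_eq_iff cong: conj_cong)
  then show ?thesis
    using assms(1) finite_auto[OF assms(1)] by simp
qed

end

theorem proposition3p2:
  fixes G :: "('a, 'b) monoid_scheme" and g :: 'a
  assumes "group G" and "finite (carrier G)" and "g \<in> carrier G"
  shows "Pr_autocomm_eq G g \<le> Pr_autocomm G
    \<and> (Pr_autocomm_eq G g = Pr_autocomm G \<longleftrightarrow> g = \<one>\<^bsub>G\<^esub>)"
proof -
  interpret group G
    by fact
  let ?N = "\<lambda>h. card {(x, \<alpha>) \<in> carrier G \<times> auto G. autocommutator G x \<alpha> = h}"
  let ?fib = "\<lambda>h x. card {\<alpha> \<in> auto G. \<alpha> x = x \<otimes>\<^bsub>G\<^esub> h}"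
  have fin: "finite (auto G)"
    by (rule finite_auto) fact
  have ne: "auto G \<noteq> {}"
    using id_in_auto by blast
  have N: "?N h = (\<Sum>x\<in>carrier G. ?fib h x)" if "h \<in> carrier G" for h
    using card_autocommutator_eq_sum[OF assms(2) that] .
  have fib_le: "?fib g x \<le> ?fib \<one>\<^bsub>G\<^esub> x" if "x \<in> carrier G" for x
    using card_auto_maps_to_le_stabiliser[OF assms(2) that] that by simp
  have le: "?N g \<le> ?N \<one>\<^bsub>G\<^esub>"
    unfolding N[OF assms(3)] N[OF one_closed] by (rule sum_mono) (rule fib_le)
  have less: "?N g < ?N \<one>\<^bsub>G\<^esub>" if "g \<noteq> \<one>\<^bsub>G\<^esub>"
  proof -
    have fixes_one: "\<alpha> \<one>\<^bsub>G\<^esub> = \<one>\<^bsub>G\<^esub>" if "\<alpha> \<in> auto G" for \<alpha>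
      using that hom_one[of \<alpha> G G] \<open>group G\<close> by (simp add: auto_def)
    have "{\<alpha> \<in> auto G. \<alpha> \<one>\<^bsub>G\<^esub> = \<one>\<^bsub>G\<^esub> \<otimes>\<^bsub>G\<^esub> g} = {}"
      using fixes_one that assms(3) by auto
    moreover have "{\<alpha> \<in> auto G. \<alpha> \<one>\<^bsub>G\<^esub> = \<one>\<^bsub>G\<^esub> \<otimes>\<^bsub>G\<^esub> \<one>\<^bsub>G\<^esub>} = auto G"
      using fixes_one by auto
    ultimately have "?fib g \<one>\<^bsub>G\<^esub> < ?fib \<one>\<^bsub>G\<^esub> \<one>\<^bsub>G\<^esub>"
      using fin ne by (simp only: card.empty card_gt_0_iff) simp
    then show ?thesis
      unfolding N[OF assms(3)] N[OF one_closed]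
      using assms(2) fib_le one_closed by (intro sum_strict_mono_ex1) auto
  qed
  have pos: "0 < card (carrier G)" "0 < card (auto G)"
    using fin ne assms(2,3) by (auto simp: card_gt_0_iff)
  show ?thesis
    unfolding Pr_autocomm_def Pr_autocomm_eq_def
    using le less pos by (cases "g = \<one>\<^bsub>G\<^esub>") (auto simp: divide_right_mono)
qed

end
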